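(* Let $m \in \mathbb{N}$ be a natural number that is not the square of an integer, and let $z = \lfloor \sqrt{m} \rfloor$. For $n \ge 1$ define the integers $$p_n = \sum_{k=1}^{n}\binom{2n-1}{2k-1} m^{n-k} z^{2k-1}, \qquad q_n = \sum_{k=0}^{n-1}\binom{2n-1}{2k} m^{n-1-k} z^{2k}.$$ Then $\left\{\frac{p_n}{q_n}\right\}_{n\ge1}$ is a nice rational approximation of $\sqrt{m}$, i.e. $0 < |q_n\sqrt{m} - p_n|$ for all $n$ and $|q_n\sqrt{m} - p_n| \to 0$ as $n \to \infty$.
   Context: $\lfloor x \rfloor$ denotes the greatest integer less than or equal to $x$. *)

theory Defs
  imports Complex_Main
begin

text \<open>The sequences are indexed by \<open>n \<ge> 1\<close>; values at \<open>0\<close> are irrelevant. The condition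
  \<open>q n \<noteq> 0\<close> only makes the fractions \<open>p n / q n\<close> well formed, since division by zero
  is total in HOL.\<close>

definition nice_rational_approximation :: "real \<Rightarrow> (nat \<Rightarrow> int) \<Rightarrow> (nat \<Rightarrow> int) \<Rightarrow> bool" where
  "nice_rational_approximation \<alpha> p q \<longleftrightarrow>
     (\<forall>n\<ge>1. q n \<noteq> 0) \<and>
     (\<forall>n\<ge>1. 0 < \<bar>real_of_int (q n) * \<alpha> - real_of_int (p n)\<bar>) \<and>
     (\<lambda>n. \<bar>real_of_int (q n) * \<alpha> - real_of_int (p n)\<bar>) \<longlonglongrightarrow> 0"

end

theory Submission
  imports Defs
begin

text \<open>Splitting the binomial expansion of \<open>(\<surd>m - z) ^ (2 n - 1)\<close> into even and odd powers of
  \<open>z\<close> gives \<open>q n \<cdot> \<surd>m - p n\<close>. Since \<open>m\<close> is not a square, \<open>0 < \<surd>m - z < 1\<close>, so these powers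
  are positive and tend to \<open>0\<close>.\<close>

text \<open>Consecutive indices \<open>2 * k\<close> and \<open>Suc (2 * k)\<close> are paired: the
  first leaves an odd power of \<open>s\<close>, hence the outer factor \<open>s\<close>; the second
  leaves an even power and the sign of \<open>- z\<close>. Keeping \<open>s\<^sup>2\<close> intact
  lets it become \<open>m\<close> later.\<close>

lemma odd_power_diff_expansion:
  fixes s z :: "'a::comm_ring_1"
  shows "(s - z) ^ Suc (2 * N) =
    (\<Sum>k=0..N. of_nat (Suc (2 * N) choose (2 * k)) * (s\<^sup>2) ^ (N - k) * z ^ (2 * k)) * s
    - (\<Sum>k=0..N. of_nat (Suc (2 * N) choose Suc (2 * k)) * (s\<^sup>2) ^ (N - k) * z ^ Suc (2 * k))"
proof -
  define g where "g j = of_nat (Suc (2 * N) choose j) * (- z) ^ j * s ^ (Suc (2 * N) - j)" for j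
  \<comment> \<open>The lower bound is written \<open>2 * 0\<close> to match
    \<open>sum.in_pairs\<close>.\<close>
  have "(s - z) ^ Suc (2 * N) = sum g {2 * 0..Suc (2 * N)}"
    using binomial_ring[of "- z" s "Suc (2 * N)"] by (simp add: g_def atMost_atLeast0)
  also have "\<dots> = (\<Sum>k=0..N. g (2 * k) + g (Suc (2 * k)))"
    by (rule sum.in_pairs)
  also have "\<dots> = (\<Sum>k=0..N.
      of_nat (Suc (2 * N) choose (2 * k)) * (s\<^sup>2) ^ (N - k) * z ^ (2 * k) * s
      - of_nat (Suc (2 * N) choose Suc (2 * k)) * (s\<^sup>2) ^ (N - k) * z ^ Suc (2 * k))"
  proof (rule sum.cong[OF refl])
    fix k assume "k \<in> {0..N}"
    then have "Suc (2 * N) - 2 * k = Suc (2 * (N - k))" "Suc (2 * N) - Suc (2 * k) = 2 * (N - k)"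
      by auto
    then show "g (2 * k) + g (Suc (2 * k)) =
        of_nat (Suc (2 * N) choose (2 * k)) * (s\<^sup>2) ^ (N - k) * z ^ (2 * k) * s
        - of_nat (Suc (2 * N) choose Suc (2 * k)) * (s\<^sup>2) ^ (N - k) * z ^ Suc (2 * k)"
      unfolding g_def by (simp add: power_mult[symmetric] power_minus_even power_minus_odd mult_ac
          del: binomial_Suc_Suc)
  qed
  finally show ?thesis
    by (simp only: sum_subtractf sum_distrib_right)
qed

text \<open>The floor gives \<open>0 \<le>\<close> and \<open>< 1\<close>; equality with
  \<open>0\<close> would make \<open>m\<close> the square of its floored root.\<close>

lemma sqrt_nonsquare_floor_frac:
  fixes m :: nat
  assumes "\<not> (\<exists>a::int. int m = a ^ 2)"
  shows "0 < sqrt (real m) - of_int \<lfloor>sqrt (real m)\<rfloor>" "sqrt (real m) - of_int \<lfloor>sqrt (real m)\<rfloor> < 1"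
proof -
  let ?z = "\<lfloor>sqrt (real m)\<rfloor>"
  have "sqrt (real m) \<noteq> of_int ?z"
  proof
    assume "sqrt (real m) = of_int ?z"
    then have "of_int (int m) = (of_int (?z ^ 2) :: real)"
      by (metis of_int_of_nat_eq of_int_power of_nat_0_le_iff real_sqrt_pow2)
    then show False
      using assms of_int_eq_iff by blast
  qed
  then show "0 < sqrt (real m) - of_int ?z"
    by (simp add: order_less_le)
  show "sqrt (real m) - of_int ?z < 1"
    by linarith
qed

theorem theorem2p1p1:
  fixes m :: nat and z :: int and p q :: "nat \<Rightarrow> int"
  assumes nonsquare: "\<not> (\<exists>a::int. int m = a ^ 2)"
    and z: "z = \<lfloor>sqrt (real m)\<rfloor>"
    and p: "\<And>n. n \<ge> 1 \<Longrightarrow>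
      p n = (\<Sum>k=1..n. int ((2 * n - 1) choose (2 * k - 1)) * int m ^ (n - k) * z ^ (2 * k - 1))"
    and q: "\<And>n. n \<ge> 1 \<Longrightarrow>
      q n = (\<Sum>k=0..n - 1. int ((2 * n - 1) choose (2 * k)) * int m ^ (n - 1 - k) * z ^ (2 * k))"
  shows "nice_rational_approximation (sqrt (real m)) p q"
proof -
  define s where "s = sqrt (real m)"
  have s2: "s\<^sup>2 = real m"
    by (simp add: s_def)
  have frac: "0 < s - of_int z" "s - of_int z < 1"
    using sqrt_nonsquare_floor_frac[OF nonsquare] by (simp_all add: s_def z)
  have "m > 0"
    using nonsquare by (metis gr0I of_nat_0 zero_power2)
  \<comment> \<open>With \<open>n = Suc N\<close> the truncated \<open>2 * n - 1\<close> becomes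
    \<open>Suc (2 * N)\<close>. Deleting \<open>binomial_Suc_Suc\<close> keeps Pascal's rule from
    splitting the coefficients.\<close>
  have qN: "q (Suc N) = (\<Sum>k=0..N. int (Suc (2 * N) choose (2 * k)) * int m ^ (N - k) * z ^ (2 * k))" for N
    by (simp add: q del: binomial_Suc_Suc)
  \<comment> \<open>The summation index moves down by one, so \<open>2 * k - 1\<close> turns into
    \<open>Suc (2 * k)\<close> and the range agrees with that of \<open>q\<close>.\<close>
  have pN: "p (Suc N) = (\<Sum>k=0..N. int (Suc (2 * N) choose Suc (2 * k)) * int m ^ (N - k) * z ^ Suc (2 * k))" for N
    using p[of "Suc N"] unfolding One_nat_def sum.shift_bounds_cl_Suc_ivl
    by (simp del: binomial_Suc_Suc)
  have diff: "of_int (q (Suc N)) * s - of_int (p (Suc N)) = (s - of_int z) ^ Suc (2 * N)" for N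
    unfolding odd_power_diff_expansion qN pN s2 by (simp del: binomial_Suc_Suc)
  have "q (Suc N) > 0" for N
  proof -
    \<comment> \<open>This is the summand \<open>k = 0\<close> of \<open>q (Suc N)\<close>; the
      others are nonnegative because \<open>z\<close> occurs only to even powers.\<close>
    have "0 < int m ^ N"
      using \<open>m > 0\<close> by simp
    also have "\<dots> \<le> q (Suc N)"
      unfolding qN using member_le_sum[of 0 "{0..N}"
          "\<lambda>k. int (Suc (2 * N) choose (2 * k)) * int m ^ (N - k) * z ^ (2 * k)"]
      by (simp del: binomial_Suc_Suc)
    finally show ?thesis .
  qed
  then have "q n \<noteq> 0" if "n \<ge> 1" for n
    using that by (metis Suc_pred' less_irrefl less_le_trans zero_less_one)
  moreover have "0 < \<bar>of_int (q n) * s - of_int (p n)\<bar>" if "n \<ge> 1" for n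
  proof -
    obtain N where "n = Suc N"
      using \<open>n \<ge> 1\<close> by (cases n) auto
    then show ?thesis
      unfolding \<open>n = Suc N\<close> diff using frac by simp
  qed
  moreover have "(\<lambda>n. \<bar>of_int (q n) * s - of_int (p n)\<bar>) \<longlonglongrightarrow> 0"
  proof -
    have "(\<lambda>n. (s - of_int z) ^ n) \<longlonglongrightarrow> 0"
      using frac by (intro LIMSEQ_realpow_zero) auto
    \<comment> \<open>The odd exponents select a subsequence of the geometric sequence.\<close>
    moreover have "strict_mono (\<lambda>N::nat. Suc (2 * N))"
      by (simp add: strict_mono_def)
    ultimately have "(\<lambda>N. (s - of_int z) ^ Suc (2 * N)) \<longlonglongrightarrow> 0"
      using LIMSEQ_subseq_LIMSEQ[unfolded o_def] by blast
    then have "(\<lambda>N. \<bar>of_int (q (Suc N)) * s - of_int (p (Suc N))\<bar>) \<longlonglongrightarrow> 0"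
      unfolding diff by (rule tendsto_rabs_zero)
    \<comment> \<open>Shifting the index back leaves the limit unchanged, whatever
      \<open>p 0\<close> and \<open>q 0\<close> are.\<close>
    then show ?thesis
      by (rule LIMSEQ_imp_Suc)
  qed
  ultimately show ?thesis
    unfolding nice_rational_approximation_def s_def by blast
qed

end
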